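(* Let $n\ge 1$ be an integer and let $\rho\in[-1,1]^{E_n}$. Then $\rho \in R(\mathcal{B}_n)$ if and only if $\tfrac12(\mathbf{1}-\rho)\in \mathrm{CUT}(n)$, where $\mathbf{1}\in\mathbb{R}^{E_n}$ is the all-ones vector. Equivalently, $R(\mathcal{B}_n)=\mathbf{1}-2\,\mathrm{CUT}(n)$.
   Context: $E_n = \{(i,j) : 1 \le i < j \le n\}$ is the edge set of the complete graph on $[n]=\{1,\ldots,n\}$. $\mathcal{B}_n$ is the set of all $n$-variate symmetric Bernoulli distributions, i.e. probability measures $\mu$ on $\{0,1\}^n$ all of whose one-dimensional marginals are Bernoulli$(1/2)$: $\sum_{\mathbf{x}\in\{0,1\}^n:\, x_k = 0}\mu(\mathbf{x}) = \tfrac12$ for $k=1,\ldots,n$. The correlation map $R:\mathcal{B}_n \to [-1,1]^{E_n}$ sends $\mu$ to the vector $R(\mu)=\rho^\mu$ with $\rho^\mu(i,j) = \operatorname{corr}(B_i,B_j) = 4\,\mathbb{E}_\mu[B_iB_j]-1$, where $(B_1,\ldots,B_n)\sim\mu$. For $S\subseteq[n]$ the cut vector $\delta(S)\in\{0,1\}^{E_n}$ is defined by $\delta(S)_{ij}=1$ if $|S\cap\{i,j\}|=1$ and $\delta(S)_{ij}=0$ otherwise. The cut polytope is $\mathrm{CUT}(n)=\operatorname{conv}\{\delta(S): S\subseteq[n]\}\subseteq\mathbb{R}^{E_n}$. *)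

theory Defs
  imports "HOL-Probability.Probability" "HOL-Library.Function_Algebras"
begin

text \<open>
  Pointwise scalar multiplication makes functions into a real vector space (addition and zero are
  those of \<^theory>\<open>HOL-Library.Function_Algebras\<close>), so that the \<open>convex hull\<close> of the library is
  available for them.
\<close>

instantiation "fun" :: (type, real_vector) real_vector
begin

definition scaleR_fun :: "real \<Rightarrow> ('a \<Rightarrow> 'b) \<Rightarrow> 'a \<Rightarrow> 'b"
  where "scaleR_fun c f = (\<lambda>x. c *\<^sub>R f x)"

instance
  by standard (simp_all add: scaleR_fun_def fun_eq_iff algebra_simps)

end

definition edge_set :: "nat \<Rightarrow> (nat \<times> nat) set"
  where "edge_set n = {(i, j). 1 \<le> i \<and> i < j \<and> j \<le> n}"

text \<open>
  A vector indexed by \<^term>\<open>edge_set n\<close> is a function on all pairs that is 0 outside of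
  \<^term>\<open>edge_set n\<close>.  Hence \<open>[-1,1]\<^sup>E\<close> is the following set, and the all-ones vector is not the
  constant function 1.
\<close>

definition edge_cube :: "nat \<Rightarrow> (nat \<times> nat \<Rightarrow> real) set"
  where "edge_cube n = PiE_dflt (edge_set n) 0 (\<lambda>_. {-1..1})"

definition ones :: "nat \<Rightarrow> nat \<times> nat \<Rightarrow> real"
  where "ones n = (\<lambda>e. if e \<in> edge_set n then 1 else 0)"

definition bin_cube :: "nat \<Rightarrow> (nat \<Rightarrow> real) set"
  where "bin_cube n = {1..n} \<rightarrow>\<^sub>E {0, 1}"

definition sym_bernoulli :: "nat \<Rightarrow> (nat \<Rightarrow> real) pmf set"
  where "sym_bernoulli n =
    {\<mu>. set_pmf \<mu> \<subseteq> bin_cube n \<and>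
         (\<forall>k\<in>{1..n}. (\<Sum>x\<in>{x \<in> bin_cube n. x k = 0}. pmf \<mu> x) = 1 / 2)}"

definition corr :: "'a pmf \<Rightarrow> ('a \<Rightarrow> real) \<Rightarrow> ('a \<Rightarrow> real) \<Rightarrow> real"
  where "corr \<mu> X Y =
    measure_pmf.expectation \<mu>
      (\<lambda>\<omega>. (X \<omega> - measure_pmf.expectation \<mu> X) * (Y \<omega> - measure_pmf.expectation \<mu> Y)) /
    sqrt (measure_pmf.variance \<mu> X * measure_pmf.variance \<mu> Y)"

definition corr_map :: "nat \<Rightarrow> (nat \<Rightarrow> real) pmf \<Rightarrow> nat \<times> nat \<Rightarrow> real"
  where "corr_map n \<mu> =
    (\<lambda>(i, j). if (i, j) \<in> edge_set n then corr \<mu> (\<lambda>x. x i) (\<lambda>x. x j) else 0)"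

definition cut_vector :: "nat \<Rightarrow> nat set \<Rightarrow> nat \<times> nat \<Rightarrow> real"
  where "cut_vector n S =
    (\<lambda>(i, j). if (i, j) \<in> edge_set n \<and> card (S \<inter> {i, j}) = 1 then 1 else 0)"

definition cut_polytope :: "nat \<Rightarrow> (nat \<times> nat \<Rightarrow> real) set"
  where "cut_polytope n = convex hull (cut_vector n ` Pow {1..n})"

lemma finite_bin_cube: "finite (bin_cube n)"
  unfolding bin_cube_def by (intro finite_PiE) auto

lemma bin_cube_cases: "x \<in> bin_cube n \<Longrightarrow> k \<in> {1..n} \<Longrightarrow> x k = 0 \<or> x k = 1"
  by (auto simp: bin_cube_def PiE_iff)

lemma sym_bernoulli_integrable:
  fixes f :: "(nat \<Rightarrow> real) \<Rightarrow> real"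
  assumes "\<mu> \<in> sym_bernoulli n"
  shows "integrable (measure_pmf \<mu>) f"
  using assms finite_subset[OF _ finite_bin_cube]
  by (auto simp: sym_bernoulli_def intro: integrable_measure_pmf_finite)

lemma sym_bernoulli_expectation:
  assumes "\<mu> \<in> sym_bernoulli n" "k \<in> {1..n}"
  shows "measure_pmf.expectation \<mu> (\<lambda>x. x k) = 1 / 2"
proof -
  have sub: "set_pmf \<mu> \<subseteq> bin_cube n"
    and half: "(\<Sum>x\<in>{x \<in> bin_cube n. x k = 0}. pmf \<mu> x) = 1 / 2"
    using assms by (auto simp: sym_bernoulli_def)
  have "measure_pmf.expectation \<mu> (\<lambda>x. x k) = (\<Sum>x\<in>bin_cube n. pmf \<mu> x * x k)"
    by (subst integral_measure_pmf[OF finite_bin_cube]) (use sub in auto)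
  also have "\<dots> = (\<Sum>x\<in>bin_cube n. pmf \<mu> x - (if x k = 0 then pmf \<mu> x else 0))"
    using bin_cube_cases[OF _ assms(2)] by (intro sum.cong) fastforce+
  also have "\<dots> = (\<Sum>x\<in>bin_cube n. pmf \<mu> x) - (\<Sum>x\<in>{x \<in> bin_cube n. x k = 0}. pmf \<mu> x)"
    by (simp add: sum_subtractf sum.If_cases[OF finite_bin_cube] Int_def)
  also have "(\<Sum>x\<in>bin_cube n. pmf \<mu> x) = 1"
    by (rule sum_pmf_eq_1[OF finite_bin_cube sub])
  finally show ?thesis using half by simp
qed

lemma sym_bernoulli_covariance:
  assumes "\<mu> \<in> sym_bernoulli n" "i \<in> {1..n}" "j \<in> {1..n}"
  shows "measure_pmf.expectation \<mu> (\<lambda>x. (x i - 1 / 2) * (x j - 1 / 2)) =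
         measure_pmf.expectation \<mu> (\<lambda>x. x i * x j) - 1 / 4"
proof -
  note [simp] = sym_bernoulli_integrable[OF assms(1)]
  have "(\<lambda>x::nat \<Rightarrow> real. (x i - 1 / 2) * (x j - 1 / 2)) =
        (\<lambda>x. x i * x j - x i / 2 - x j / 2 + 1 / 4)"
    by (auto simp: fun_eq_iff field_simps)
  then show ?thesis
    using sym_bernoulli_expectation[OF assms(1,2)] sym_bernoulli_expectation[OF assms(1,3)]
    by simp
qed

lemma sym_bernoulli_variance:
  assumes "\<mu> \<in> sym_bernoulli n" "k \<in> {1..n}"
  shows "measure_pmf.variance \<mu> (\<lambda>x. x k) = 1 / 4"
proof -
  have "measure_pmf.expectation \<mu> (\<lambda>x. x k * x k) = measure_pmf.expectation \<mu> (\<lambda>x. x k)"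
    using assms bin_cube_cases[OF _ assms(2)]
    by (intro integral_cong_AE) (fastforce simp: sym_bernoulli_def AE_measure_pmf_iff)+
  then show ?thesis
    unfolding power2_eq_square sym_bernoulli_expectation[OF assms]
      sym_bernoulli_covariance[OF assms assms(2)] by simp
qed

lemma corr_map_eq:
  assumes "\<mu> \<in> sym_bernoulli n" "(i, j) \<in> edge_set n"
  shows "corr_map n \<mu> (i, j) = 4 * measure_pmf.expectation \<mu> (\<lambda>x. x i * x j) - 1"
proof -
  have ij: "i \<in> {1..n}" "j \<in> {1..n}" using assms(2) by (auto simp: edge_set_def)
  have "corr \<mu> (\<lambda>x. x i) (\<lambda>x. x j) = 4 * measure_pmf.expectation \<mu> (\<lambda>x. x i * x j) - 1"
    unfolding corr_def sym_bernoulli_variance[OF assms(1) ij(1)]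
      sym_bernoulli_variance[OF assms(1) ij(2)]
    unfolding sym_bernoulli_expectation[OF assms(1) ij(1)]
      sym_bernoulli_expectation[OF assms(1) ij(2)] sym_bernoulli_covariance[OF assms(1) ij]
    by (simp add: real_sqrt_divide)
  then show ?thesis
    using assms(2) by (simp add: corr_map_def)
qed

lemma corr_map_in_edge_cube:
  assumes "\<mu> \<in> sym_bernoulli n"
  shows "corr_map n \<mu> \<in> edge_cube n"
proof -
  have "corr_map n \<mu> (i, j) \<in> {-1..1}" if e: "(i, j) \<in> edge_set n" for i j
  proof -
    have ij: "i \<in> {1..n}" "j \<in> {1..n}" using e by (auto simp: edge_set_def)
    have AE: "AE x in measure_pmf \<mu>. 0 \<le> x i * x j \<and> x i * x j \<le> x i"
    proof -
      have "0 \<le> x i * x j \<and> x i * x j \<le> x i" if "x \<in> bin_cube n" for x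
        using bin_cube_cases[OF that ij(1)] bin_cube_cases[OF that ij(2)] by auto
      then show ?thesis using assms by (auto simp: AE_measure_pmf_iff sym_bernoulli_def)
    qed
    have "0 \<le> measure_pmf.expectation \<mu> (\<lambda>x. x i * x j)"
      using AE by (intro integral_nonneg_AE) auto
    moreover have "measure_pmf.expectation \<mu> (\<lambda>x. x i * x j) \<le> measure_pmf.expectation \<mu> (\<lambda>x. x i)"
      using AE sym_bernoulli_integrable[OF assms] by (intro integral_mono_AE) auto
    ultimately show ?thesis
      using corr_map_eq[OF assms e] sym_bernoulli_expectation[OF assms ij(1)] by simp
  qed
  then show ?thesis by (auto simp: edge_cube_def PiE_dflt_def corr_map_def)
qed

end

theory Submission
  imports Defs
begin

text \<open>
  For \<open>x \<in> {0,1}\<^sup>n\<close> with support \<open>S\<close>, the entry of the cut vector of \<open>S\<close> at \<open>(i, j)\<close> is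
  \<open>x\<^sub>i + x\<^sub>j - 2 x\<^sub>i x\<^sub>j\<close>.  Taking expectations under a symmetric Bernoulli law identifies
  \<open>(1 - \<rho>) / 2\<close> with the mean of the random cut vector, which lies in the cut polytope.
  Conversely, these means form a convex set, since mixtures of symmetric Bernoulli laws are again
  symmetric Bernoulli, and every cut vector is attained: a set and its complement have the same
  cut vector, and the uniform law on the two indicators has symmetric marginals.
\<close>

definition support :: "nat \<Rightarrow> (nat \<Rightarrow> real) \<Rightarrow> nat set"
  where "support n x = {k \<in> {1..n}. x k = 1}"

text \<open>Points of \<open>bin_cube n\<close> are extensional, i.e. \<open>undefined\<close>
  outside \<open>{1..n}\<close>; hence the \<open>restrict\<close>.\<close>

definition cube_indicator :: "nat \<Rightarrow> nat set \<Rightarrow> nat \<Rightarrow> real"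
  where "cube_indicator n S = restrict (indicator S) {1..n}"

text \<open>The expected cut vector, written as a finite sum so that it is visibly a convex
  combination of cut vectors and linear in the point masses.\<close>

definition mean_cut :: "nat \<Rightarrow> (nat \<Rightarrow> real) pmf \<Rightarrow> nat \<times> nat \<Rightarrow> real"
  where "mean_cut n \<mu> = (\<Sum>x\<in>bin_cube n. pmf \<mu> x *\<^sub>R cut_vector n (support n x))"

definition mixture :: "real \<Rightarrow> 'a pmf \<Rightarrow> 'a pmf \<Rightarrow> 'a pmf"
  where "mixture t \<mu> \<nu> = bind_pmf (bernoulli_pmf t) (\<lambda>b. if b then \<mu> else \<nu>)"

lemma sum_fun_apply: "(\<Sum>x\<in>A. f x) y = (\<Sum>x\<in>A. f x y)"
  for f :: "'a \<Rightarrow> 'b \<Rightarrow> 'c::comm_monoid_add"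
  by (induction A rule: infinite_finite_induct) auto

lemma pmf_mixture:
  assumes "0 \<le> t" "t \<le> 1"
  shows "pmf (mixture t \<mu> \<nu>) x = t * pmf \<mu> x + (1 - t) * pmf \<nu> x"
  using assms by (simp add: mixture_def pmf_bind)

lemma set_pmf_mixture: "set_pmf (mixture t \<mu> \<nu>) \<subseteq> set_pmf \<mu> \<union> set_pmf \<nu>"
  by (auto simp: mixture_def split: if_splits)

lemma sum_pmf_mixture:
  assumes "0 \<le> t" "t \<le> 1"
  shows "(\<Sum>x\<in>A. pmf (mixture t \<mu> \<nu>) x) = t * (\<Sum>x\<in>A. pmf \<mu> x) + (1 - t) * (\<Sum>x\<in>A. pmf \<nu> x)"
  by (simp add: pmf_mixture[OF assms] sum.distrib sum_distrib_left)

text \<open>The marginal conditions are linear in the point masses, and t/2 + (1 - t)/2 =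
  1/2.\<close>

lemma mixture_sym_bernoulli:
  assumes "\<mu> \<in> sym_bernoulli n" "\<nu> \<in> sym_bernoulli n" "0 \<le> t" "t \<le> 1"
  shows "mixture t \<mu> \<nu> \<in> sym_bernoulli n"
  using assms set_pmf_mixture[of t \<mu> \<nu>]
  by (auto simp: sym_bernoulli_def sum_pmf_mixture field_simps)

lemma mean_cut_mixture:
  assumes "0 \<le> t" "t \<le> 1"
  shows "mean_cut n (mixture t \<mu> \<nu>) = t *\<^sub>R mean_cut n \<mu> + (1 - t) *\<^sub>R mean_cut n \<nu>"
  by (simp add: mean_cut_def pmf_mixture[OF assms] scaleR_add_left sum.distrib scaleR_sum_right)

lemma mean_cut_return:
  assumes "x \<in> bin_cube n"
  shows "mean_cut n (return_pmf x) = cut_vector n (support n x)"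
proof -
  have "mean_cut n (return_pmf x) =
        (\<Sum>y\<in>bin_cube n. if y = x then cut_vector n (support n y) else 0)"
    unfolding mean_cut_def by (intro sum.cong) (auto simp: indicator_def)
  then show ?thesis
    using assms finite_bin_cube by simp
qed

lemma cube_indicator_in_bin_cube: "cube_indicator n S \<in> bin_cube n"
  by (auto simp: cube_indicator_def bin_cube_def indicator_def)

lemma support_cube_indicator: "S \<subseteq> {1..n} \<Longrightarrow> support n (cube_indicator n S) = S"
  by (auto simp: support_def cube_indicator_def indicator_def split: if_splits)

lemma card_Int_pair_eq_1_iff:
  "i \<noteq> j \<Longrightarrow> card (S \<inter> {i, j}) = 1 \<longleftrightarrow> (i \<in> S) \<noteq> (j \<in> S)"
  by (cases "i \<in> S"; cases "j \<in> S") (auto simp: Int_insert_right)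

text \<open>Both ends of an edge lie in \<open>{1..n}\<close>, so complementing there flips both
  memberships and preserves whether they differ.\<close>

lemma cut_vector_complement: "cut_vector n ({1..n} - S) = cut_vector n S"
proof -
  have "card (({1..n} - S) \<inter> {i, j}) = 1 \<longleftrightarrow> card (S \<inter> {i, j}) = 1"
    if "(i, j) \<in> edge_set n" for i j
    using that card_Int_pair_eq_1_iff[of i j] by (auto simp: edge_set_def)
  then show ?thesis
    by (auto simp: cut_vector_def fun_eq_iff)
qed

text \<open>For bits a and b, a + b - 2ab is their exclusive or.\<close>

lemma cut_vector_support:
  assumes "x \<in> bin_cube n" "(i, j) \<in> edge_set n"
  shows "cut_vector n (support n x) (i, j) = x i + x j - 2 * (x i * x j)"
proof -
  have ij: "i \<in> {1..n}" "j \<in> {1..n}" "i \<noteq> j"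
    using assms(2) by (auto simp: edge_set_def)
  show ?thesis
    using bin_cube_cases[OF assms(1) ij(1)] bin_cube_cases[OF assms(1) ij(2)] ij assms(2)
      card_Int_pair_eq_1_iff[OF ij(3), of "support n x"]
    by (auto simp: cut_vector_def support_def)
qed

lemma mean_cut_eq:
  assumes "\<mu> \<in> sym_bernoulli n"
  shows "mean_cut n \<mu> = (1 / 2) *\<^sub>R (ones n - corr_map n \<mu>)"
proof (rule ext, clarify)
  fix i j
  note [simp] = sym_bernoulli_integrable[OF assms]
  have app: "mean_cut n \<mu> (i, j) =
      (\<Sum>x\<in>bin_cube n. pmf \<mu> x * cut_vector n (support n x) (i, j))"
    by (simp add: mean_cut_def sum_fun_apply scaleR_fun_def)
  show "mean_cut n \<mu> (i, j) = ((1 / 2) *\<^sub>R (ones n - corr_map n \<mu>)) (i, j)"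
  proof (cases "(i, j) \<in> edge_set n")
    \<comment> \<open>Off the edge set both sides vanish; here it matters that \<open>ones n\<close>
      is 0 there.\<close>
    case False
    then show ?thesis
      by (simp add: app cut_vector_def scaleR_fun_def ones_def corr_map_def)
  next
    case True
    then have ij: "i \<in> {1..n}" "j \<in> {1..n}"
      by (auto simp: edge_set_def)
    have "mean_cut n \<mu> (i, j) = (\<Sum>x\<in>bin_cube n. pmf \<mu> x * (x i + x j - 2 * (x i * x j)))"
      by (simp add: app cut_vector_support[OF _ True])
    also have "\<dots> = measure_pmf.expectation \<mu> (\<lambda>x. x i + x j - 2 * (x i * x j))"
      using assms
      by (subst integral_measure_pmf[OF finite_bin_cube]) (auto simp: sym_bernoulli_def)
    \<comment> \<open>The two marginal means of 1/2 add up to the constant 1, so only the mixed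
      moment still depends on \<open>\<mu>\<close>.\<close>
    also have "\<dots> = 1 - 2 * measure_pmf.expectation \<mu> (\<lambda>x. x i * x j)"
      using sym_bernoulli_expectation[OF assms ij(1)] sym_bernoulli_expectation[OF assms ij(2)]
      by simp
    finally show ?thesis
      using corr_map_eq[OF assms True] True by (simp add: scaleR_fun_def ones_def)
  qed
qed

lemma mean_cut_in_cut_polytope:
  assumes "\<mu> \<in> sym_bernoulli n"
  shows "mean_cut n \<mu> \<in> cut_polytope n"
  unfolding mean_cut_def
proof (rule convex_sum[OF finite_bin_cube])
  show "convex (cut_polytope n)"
    by (simp add: cut_polytope_def)
  show "(\<Sum>x\<in>bin_cube n. pmf \<mu> x) = 1"
    using assms by (intro sum_pmf_eq_1 finite_bin_cube) (auto simp: sym_bernoulli_def)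
  show "cut_vector n (support n x) \<in> cut_polytope n" for x
    unfolding cut_polytope_def by (rule hull_inc) (auto simp: support_def)
qed simp

lemma convex_mean_cut_image: "convex (mean_cut n ` sym_bernoulli n)"
proof (rule convexI)
  fix a b :: "nat \<times> nat \<Rightarrow> real" and u v :: real
  assume "a \<in> mean_cut n ` sym_bernoulli n" "b \<in> mean_cut n ` sym_bernoulli n"
    and uv: "0 \<le> u" "0 \<le> v" "u + v = 1"
  then obtain \<mu> \<nu> where mn: "\<mu> \<in> sym_bernoulli n" "\<nu> \<in> sym_bernoulli n"
    and ab: "a = mean_cut n \<mu>" "b = mean_cut n \<nu>"
    by blast
  have v: "v = 1 - u" and u: "u \<le> 1"
    using uv by auto
  show "u *\<^sub>R a + v *\<^sub>R b \<in> mean_cut n ` sym_bernoulli n"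
    unfolding ab v mean_cut_mixture[OF uv(1) u, symmetric]
    using mixture_sym_bernoulli[OF mn uv(1) u] by blast
qed

lemma cut_vector_in_mean_cut_image:
  assumes S: "S \<subseteq> {1..n}"
  shows "cut_vector n S \<in> mean_cut n ` sym_bernoulli n"
proof -
  let ?x = "cube_indicator n S" and ?y = "cube_indicator n ({1..n} - S)"
  let ?\<mu> = "mixture (1 / 2) (return_pmf ?x) (return_pmf ?y)"
  have sum_return: "(\<Sum>z\<in>{z \<in> bin_cube n. z k = 0}. pmf (return_pmf w) z) =
      (if w k = 0 then 1 else 0)" if "w \<in> bin_cube n" for w k
    using that finite_bin_cube[of n] by (auto simp: indicator_def)
  \<comment> \<open>At each \<open>k\<close> in \<open>{1..n}\<close> exactly one of the two
    indicators vanishes, so the event \<open>z k = 0\<close> has mass 1/2.\<close>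
  have "?\<mu> \<in> sym_bernoulli n"
    using set_pmf_mixture[of "1 / 2" "return_pmf ?x" "return_pmf ?y"]
    by (auto simp: sym_bernoulli_def sum_pmf_mixture sum_return cube_indicator_in_bin_cube
        simp del: pmf_return)
      (auto simp: cube_indicator_def indicator_def split: if_splits)
  \<comment> \<open>Both point masses contribute the same cut vector, with weights adding up to
    1.\<close>
  moreover have "mean_cut n ?\<mu> = cut_vector n S"
    using S by (simp add: mean_cut_mixture mean_cut_return cube_indicator_in_bin_cube
        support_cube_indicator cut_vector_complement
        del: One_nat_def flip: scaleR_add_left)
  ultimately show ?thesis
    by (metis image_eqI)
qed

lemma mean_cut_image: "mean_cut n ` sym_bernoulli n = cut_polytope n"
proof
  show "cut_polytope n \<subseteq> mean_cut n ` sym_bernoulli n"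
    \<comment> \<open>A convex set containing all cut vectors contains their hull.\<close>
    unfolding cut_polytope_def
    by (intro hull_minimal convex_mean_cut_image) (blast intro: cut_vector_in_mean_cut_image)
qed (auto intro: mean_cut_in_cut_polytope)

theorem theorem2:
  fixes n :: nat
  assumes "n \<ge> 1"
  shows "(\<forall>\<rho> \<in> edge_cube n.
            \<rho> \<in> corr_map n ` sym_bernoulli n \<longleftrightarrow> (1 / 2) *\<^sub>R (ones n - \<rho>) \<in> cut_polytope n)
       \<and> corr_map n ` sym_bernoulli n = (\<lambda>c. ones n - 2 *\<^sub>R c) ` cut_polytope n"
proof -
  have "corr_map n \<mu> = ones n - 2 *\<^sub>R mean_cut n \<mu>" if "\<mu> \<in> sym_bernoulli n" for \<mu>
    by (simp add: mean_cut_eq[OF that])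
  then have image: "corr_map n ` sym_bernoulli n = (\<lambda>c. ones n - 2 *\<^sub>R c) ` cut_polytope n"
    unfolding mean_cut_image[symmetric] image_image by (rule image_cong[OF refl])
  have "\<rho> \<in> corr_map n ` sym_bernoulli n \<longleftrightarrow> (1 / 2) *\<^sub>R (ones n - \<rho>) \<in> cut_polytope n" for \<rho>
  proof
    assume "(1 / 2) *\<^sub>R (ones n - \<rho>) \<in> cut_polytope n"
    \<comment> \<open>The map sending c to \<open>ones n - 2 *\<^sub>R c\<close> is inverse to the
      one sending \<open>\<rho>\<close> to \<open>(1 / 2) *\<^sub>R (ones n - \<rho>)\<close>, so
      the equality of images yields the pointwise criterion.\<close>
    then have "ones n - 2 *\<^sub>R ((1 / 2) *\<^sub>R (ones n - \<rho>)) \<in> corr_map n ` sym_bernoulli n"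
      unfolding image by (rule imageI)
    then show "\<rho> \<in> corr_map n ` sym_bernoulli n"
      by simp
  qed (auto simp: image)
  with image show ?thesis
    by blast
qed

end
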